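(* Let $\mathfrak X=\{1,\dots,n\}$, and let $\mathbf f(1),\dots,\mathbf f(n)\in\mathbb R^m$ be non-zero vectors spanning $\mathbb R^m$. Let $\gamma\ge 1/m$, and let $\mathbf w^0\in\Xi_R$ be any regular initial design. Run the randomized exchange algorithm REX for $D$-optimality (as described in the context, with the $D$-optimal step-length rule $\alpha^*_{u,v}$ given there and without a stopping rule) from $\mathbf w^0$. Then REX converges to a $D$-optimal design in the following sense: the sequence of values $\Phi_D(\mathbf M(\mathbf w))$ of the successive designs $\mathbf w$ produced by the algorithm converges to the $D$-optimal value $\Phi^*=\max_{\mathbf w\in\Xi}\Phi_D(\mathbf M(\mathbf w))$. The convergence is sure convergence, i.e. it holds for every realization of the random permutations used by the algorithm.
   Context: Designs. $\Xi=\{\mathbf w\in\mathbb R^n: w_x\ge 0\ \forall x,\ \sum_x w_x=1\}$ is the set of designs; $\operatorname{supp}(\mathbf w)=\{x\in\mathfrak X: w_x>0\}$; $\mathbf M(\mathbf w)=\sum_{x\in\mathfrak X}w_x\mathbf f(x)\mathbf f(x)'$ is the information matrix (prime denotes transpose); $\Xi_R=\{\mathbf w\in\Xi:\mathbf M(\mathbf w)\text{ is non-singular}\}$ is the set of regular designs; $\mathbf e_x$ is the $x$-th standard unit vector of $\mathbb R^n$. The $D$-criterion is $\Phi_D(\mathbf M)=(\det\mathbf M)^{1/m}$ for non-negative definite $\mathbf M$ (so it equals $0$ for singular $\mathbf M$). A design is $D$-optimal if it maximizes $\Phi_D(\mathbf M(\cdot))$ over $\Xi$. Variance function. For $\mathbf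 w\in\Xi_R$ and $u,v\in\mathfrak X$ put $d_{u,v}(\mathbf w)=\mathbf f(u)'\mathbf M(\mathbf w)^{-1}\mathbf f(v)$ and $d_u(\mathbf w)=d_{u,u}(\mathbf w)$. Step-length rule. For $\mathbf w\in\Xi_R$ and $u,v\in\mathfrak X$, $\alpha^*_{u,v}(\mathbf w)\in[-w_v,w_u]$ is defined as follows. If $w_u=w_v=0$, then $\alpha^*_{u,v}(\mathbf w)=0$. Otherwise, if $\mathbf f(u),\mathbf f(v)$ are linearly independent, $$\alpha^*_{u,v}(\mathbf w)=\min\Big\{w_u,\max\Big\{-w_v,\frac{d_v(\mathbf w)-d_u(\mathbf w)}{2[d_u(\mathbf w)d_v(\mathbf w)-d_{u,v}(\mathbf w)^2]}\Big\}\Big\},$$ and if $\mathbf f(u),\mathbf f(v)$ are linearly dependent, $\alpha^*_{u,v}(\mathbf w)$ equals $w_u$ if $d_u(\mathbf w)<d_v(\mathbf w)$, $0$ if $d_u(\mathbf w)=d_v(\mathbf w)$, and $-w_v$ if $d_u(\mathbf w)>d_v(\mathbf w)$. This is a maximizer of $\Phi_D(\mathbf M(\mathbf w+\alpha(\mathbf e_v-\mathbf e_u)))$ over $\alpha\in[-w_v,w_u]$. The exchange between $u$ and $v$ replaces $\mathbf w$ by $\mathbf w+\alpha^*_{u,v}(\mathbf w)(\mathbf e_v-\mathbf e_u)$; it is called nullifying if $\alpha^*_{u,v}(\mathbf w)\in\{-w_v,w_u\}$. Algorithm REX ($D$-optimality). Start with $\mathbf w=\mathbf w^0\in\Xi_R$.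 Each iteration consists of the following, where $\mathbf w$ always denotes the current design: 1. (Leading Bohning exchange, LBE.) Choose $k\in\arg\min\{d_u(\mathbf w):u\in\operatorname{supp}(\mathbf w)\}$ and $l\in\arg\max\{d_v(\mathbf w):v\in\mathfrak X\}$ and set $\mathbf w\leftarrow\mathbf w+\alpha^*_{k,l}(\mathbf w)(\mathbf e_l-\mathbf e_k)$. Record whether this exchange was nullifying. 2. Let $(k_1,\dots,k_K)$ be a uniform random permutation of $\operatorname{supp}(\mathbf w)$, $K=|\operatorname{supp}(\mathbf w)|$. Let $L=\min(\lfloor\gamma m\rfloor,n)$ and let $(l_1,\dots,l_L)$ be a uniform random permutation of the set of indices of the $L$ largest components of the vector $(d_x(\mathbf w))_{x\in\mathfrak X}$ (ties broken arbitrarily). 3. Go through the pairs $(k_1,l_1),(k_2,l_1),\dots,(k_K,l_1),\dots,(k_1,l_L),\dots,(k_K,l_L)$ in this order. For each pair $(u,v)$ compute $\alpha^*=\alpha^*_{u,v}(\mathbf w)$ at the current $\mathbf w$; if the LBE of this iteration was not nullifying, or if $\alpha^*\in\{-w_v,w_u\}$, then set $\mathbf w\leftarrow\mathbf w+\alpha^*(\mathbf e_v-\mathbf e_u)$; otherwise leave $\mathbf w$ unchanged. Then start the next iteration. *)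

theory Defs
  imports "HOL-Analysis.Analysis"
begin

text \<open>
  The design space is a finite type \<open>'n\<close> with \<open>n = CARD('n)\<close> points, the parameter space is
  \<open>real ^ 'm\<close> with \<open>m = CARD('m)\<close>, and \<open>f x\<close> is the regressor of the design point \<open>x\<close>.
\<close>

definition designs :: "(real ^ 'n) set" where
  "designs = {w. (\<forall>x. 0 \<le> w $ x) \<and> (\<Sum>x\<in>UNIV. w $ x) = 1}"

definition supp :: "real ^ 'n \<Rightarrow> 'n set" where
  "supp w = {x. 0 < w $ x}"

definition info_matrix :: "('n::finite \<Rightarrow> real ^ 'm) \<Rightarrow> real ^ 'n \<Rightarrow> real ^ 'm ^ 'm" where
  "info_matrix f w =
     (\<Sum>x\<in>UNIV. w $ x *\<^sub>R (columnvector (f x) ** (rowvector (f x) :: real ^ 'm ^ 1)))"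

definition regular_designs :: "('n::finite \<Rightarrow> real ^ 'm) \<Rightarrow> (real ^ 'n) set" where
  "regular_designs f = {w \<in> designs. invertible (info_matrix f w)}"

text \<open>Only meant for non-negative definite arguments; \<open>0 powr a = 0\<close> covers the singular ones.\<close>

definition D_criterion :: "real ^ 'm ^ 'm \<Rightarrow> real" where
  "D_criterion M = det M powr (1 / real CARD('m))"

definition D_optimal :: "('n::finite \<Rightarrow> real ^ 'm) \<Rightarrow> real ^ 'n \<Rightarrow> bool" where
  "D_optimal f w \<longleftrightarrow> is_arg_max (\<lambda>w. D_criterion (info_matrix f w)) (\<lambda>w. w \<in> designs) w"

definition covar :: "('n::finite \<Rightarrow> real ^ 'm) \<Rightarrow> real ^ 'n \<Rightarrow> 'n \<Rightarrow> 'n \<Rightarrow> real" where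
  "covar f w u v = f u \<bullet> (matrix_inv (info_matrix f w) *v f v)"

abbreviation var :: "('n::finite \<Rightarrow> real ^ 'm) \<Rightarrow> real ^ 'n \<Rightarrow> 'n \<Rightarrow> real" where
  "var f w u \<equiv> covar f w u u"

text \<open>
  Linear independence of the two-element family \<open>(a, b)\<close>. The conjunct \<open>a \<noteq> b\<close> is needed
  because for \<open>a = b\<close> the set \<open>{a, b}\<close> collapses to a singleton.
\<close>

definition indep_pair :: "real ^ 'm \<Rightarrow> real ^ 'm \<Rightarrow> bool" where
  "indep_pair a b \<longleftrightarrow> a \<noteq> b \<and> independent {a, b}"

definition step_length :: "('n::finite \<Rightarrow> real ^ 'm) \<Rightarrow> real ^ 'n \<Rightarrow> 'n \<Rightarrow> 'n \<Rightarrow> real" where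
  "step_length f w u v =
     (if w $ u = 0 \<and> w $ v = 0 then 0
      else if indep_pair (f u) (f v) then
        min (w $ u) (max (- (w $ v))
          ((var f w v - var f w u) / (2 * (var f w u * var f w v - (covar f w u v)\<^sup>2))))
      else if var f w u < var f w v then w $ u
      else if var f w u = var f w v then 0
      else - (w $ v))"

definition exchange :: "('n::finite \<Rightarrow> real ^ 'm) \<Rightarrow> real ^ 'n \<Rightarrow> 'n \<Rightarrow> 'n \<Rightarrow> real ^ 'n" where
  "exchange f w u v = w + step_length f w u v *\<^sub>R (axis v 1 - axis u 1)"

definition nullifying :: "('n::finite \<Rightarrow> real ^ 'm) \<Rightarrow> real ^ 'n \<Rightarrow> 'n \<Rightarrow> 'n \<Rightarrow> bool" where
  "nullifying f w u v \<longleftrightarrow> step_length f w u v \<in> {- (w $ v), w $ u}"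

text \<open>
  \<open>exchange_pass f b w ps\<close> is the list of all designs obtained while going through the pairs
  \<open>ps\<close> starting from \<open>w\<close> (excluding \<open>w\<close> itself); the flag \<open>b\<close> says whether only nullifying
  exchanges are performed. A skipped pair repeats the current design.
\<close>

fun exchange_pass ::
    "('n::finite \<Rightarrow> real ^ 'm) \<Rightarrow> bool \<Rightarrow> real ^ 'n \<Rightarrow> ('n \<times> 'n) list \<Rightarrow> (real ^ 'n) list" where
  "exchange_pass f b w [] = []"
| "exchange_pass f b w ((u, v) # ps) =
     (let w' = (if \<not> b \<or> nullifying f w u v then exchange f w u v else w)
      in w' # exchange_pass f b w' ps)"

text \<open>\<open>S\<close> is an index set of the \<open>card S\<close> largest values of \<open>g\<close>, ties broken arbitrarily.\<close>

definition largest :: "('n \<Rightarrow> real) \<Rightarrow> 'n set \<Rightarrow> bool" where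
  "largest g S \<longleftrightarrow> (\<forall>x\<in>S. \<forall>y. y \<notin> S \<longrightarrow> g y \<le> g x)"

text \<open>
  \<open>rex_iteration f \<gamma> w ws\<close>: one iteration of the algorithm started at \<open>w\<close> can produce the
  successive designs \<open>ws\<close>, the last of which is the design at the end of the iteration. The
  leading exchange gives \<open>w1\<close>. The relation covers every choice in the two arguments of the
  leading exchange, every tie-breaking, and every pair of permutations \<open>ks\<close>, \<open>ls\<close>; in the
  list of pairs the component from \<open>ks\<close> varies fastest.
\<close>

inductive rex_iteration ::
    "('n::finite \<Rightarrow> real ^ 'm) \<Rightarrow> real \<Rightarrow> real ^ 'n \<Rightarrow> (real ^ 'n) list \<Rightarrow> bool"
  for f :: "'n::finite \<Rightarrow> real ^ 'm" and \<gamma> :: real and w :: "real ^ 'n" where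
  "rex_iteration f \<gamma> w (w1 # exchange_pass f (nullifying f w k l) w1 [(u, v). v \<leftarrow> ls, u \<leftarrow> ks])"
  if "is_arg_min (var f w) (\<lambda>u. u \<in> supp w) k"
    and "is_arg_max (var f w) (\<lambda>v. v \<in> UNIV) l"
    and "w1 = exchange f w k l"
    and "distinct ks" and "set ks = supp w1"
    and "distinct ls" and "largest (var f w1) (set ls)"
    and "length ls = min (nat \<lfloor>\<gamma> * real CARD('m)\<rfloor>) CARD('n)"

text \<open>
  A run is the sequence \<open>W\<close> of all successive designs, one for each exchange considered;
  \<open>T i\<close> is the position at which iteration \<open>i\<close> starts, so iteration \<open>i\<close> produces the block
  \<open>W (T i + 1), \<dots>, W (T (i + 1))\<close>.
\<close>

definition rex_run ::
    "('n::finite \<Rightarrow> real ^ 'm) \<Rightarrow> real \<Rightarrow> real ^ 'n \<Rightarrow> (nat \<Rightarrow> real ^ 'n) \<Rightarrow> bool" where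
  "rex_run f \<gamma> w0 W \<longleftrightarrow> W 0 = w0 \<and>
     (\<exists>T. T 0 = 0 \<and> strict_mono T \<and>
        (\<forall>i. rex_iteration f \<gamma> (W (T i)) (map W [Suc (T i)..<Suc (T (Suc i))])))"

end

theory Submission
  imports Defs
begin

text \<open>
  If the exchange between \<open>u\<close> and \<open>v\<close> has step length \<open>\<alpha>\<close>, it multiplies the determinant of the
  information matrix by at least \<open>1 + \<alpha> (d\<^sub>v - d\<^sub>u) / 2\<close>, where \<open>\<alpha> (d\<^sub>v - d\<^sub>u) \<ge> 0\<close>. Hence the
  determinants increase to a limit. Suppose that it is smaller than the maximal determinant
  \<open>D\<^sup>*\<close>. Since \<open>ln (D\<^sup>* / det M) \<le> max d - m\<close>, there is a \<open>\<delta> > 0\<close> with \<open>max d \<ge> m + \<delta>\<close> throughout,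
  while \<open>min d \<le> m\<close> on the support. A non-nullifying leading exchange then gains a constant
  factor, so that all leading exchanges, and with them all exchanges, are eventually nullifying.
  Such an exchange only moves or merges weights, so the positive weights stay bounded below by
  some \<open>\<epsilon> > 0\<close>. But then a nullifying leading exchange also gains a constant factor
  \<open>1 + \<epsilon> \<delta> / 2\<close>, which is a contradiction.
\<close>

subsection \<open>Determinants of real matrices\<close>

lemma sym_matrix_dot:
  fixes M :: "real^'m^'m"
  assumes "transpose M = M"
  shows "x \<bullet> (M *v y) = y \<bullet> (M *v x)"
  by (metis assms dot_lmul_matrix inner_commute transpose_matrix_vector)

text \<open>First-order condition: \<open>b\<close> minimizes the form on \<open>V\<close>, so the
  linear term of the form along \<open>b + t *\<^sub>R y\<close> must vanish.\<close>

lemma psd_form_null: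
  fixes A :: "real^'m^'m"
  assumes sym: "transpose A = A" and V: "subspace V" "b \<in> V" "y \<in> V"
    and psd: "\<And>x. x \<in> V \<Longrightarrow> 0 \<le> x \<bullet> (A *v x)" and "b \<bullet> (A *v b) = 0"
  shows "y \<bullet> (A *v b) = 0"
proof (rule ccontr)
  define p q where "p = y \<bullet> (A *v b)" and "q = y \<bullet> (A *v y)"
  assume "y \<bullet> (A *v b) \<noteq> 0"
  then have p: "p \<noteq> 0" by (simp add: p_def)
  have q: "0 \<le> q" using psd V by (simp add: q_def)
  \<comment> \<open>The form along the line is \<open>2 * t * p + t\<^sup>2 * q\<close>, minimal at
    \<open>- p / q\<close>; the added 1 covers \<open>q = 0\<close> and still gives a negative
    value.\<close>
  define t where "t = - p / (q + 1)"
  have "0 \<le> (b + t *\<^sub>R y) \<bullet> (A *v (b + t *\<^sub>R y))"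
    by (rule psd) (use V in \<open>simp add: subspace_add subspace_scale\<close>)
  also have "\<dots> = 2 * t * p + t\<^sup>2 * q"
    using assms(6) sym_matrix_dot[OF sym, of b y]
    by (simp add: matrix_vector_right_distrib matrix_vector_mult_scaleR inner_add inner_right_distrib
        p_def q_def power2_eq_square algebra_simps)
  also have "\<dots> = - (p\<^sup>2 * (q + 2)) / (q + 1)\<^sup>2"
    using q by (simp add: t_def divide_simps power2_eq_square) (simp add: algebra_simps)
  also have "\<dots> < 0"
    using p q by (simp add: divide_neg_pos)
  finally show False by simp
qed

text \<open>
  A new basis vector maximizes the Rayleigh quotient of \<open>N\<close> relative to \<open>M\<close> on the
  \<open>M\<close>-orthogonal complement of the previous ones.
\<close>

lemma generalized_eigenbasis:
  fixes M N :: "real^'m^'m"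
  assumes symM: "transpose M = M" and symN: "transpose N = N"
    and pd: "\<And>x. x \<noteq> 0 \<Longrightarrow> 0 < x \<bullet> (M *v x)"
  shows "\<exists>b :: 'm \<Rightarrow> real^'m. \<exists>ev. (\<forall>i\<in>I. \<forall>j\<in>I. b i \<bullet> (M *v b j) = (if i = j then 1 else 0)) \<and>
    (\<forall>i\<in>I. N *v b i = ev i *\<^sub>R (M *v b i))"
proof -
  have "finite I" by simp
  then show ?thesis
  proof (induction I)
    case empty
    then show ?case by simp
  next
    case (insert k I)
    then obtain b ev where orth: "\<And>i j. i \<in> I \<Longrightarrow> j \<in> I \<Longrightarrow> b i \<bullet> (M *v b j) = (if i = j then 1 else 0)"
      and eig: "\<And>i. i \<in> I \<Longrightarrow> N *v b i = ev i *\<^sub>R (M *v b i)"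
      by blast
    define V where "V = {x. \<forall>j\<in>I. x \<bullet> (M *v b j) = 0}"
    have V: "subspace V"
      by (auto simp: V_def subspace_def inner_add_left)
    \<comment> \<open>Fewer than m vectors \<open>M *v b j\<close> leave a non-zero vector
      orthogonal to all of them, so \<open>S\<close> is non-empty.\<close>
    have "I \<noteq> UNIV" using insert.hyps by auto
    then have "card I < CARD('m)"
      by (metis card_subset_eq finite_code less_le subset_UNIV card_mono)
    then have "dim ((\<lambda>j. M *v b j) ` I) < DIM(real^'m)"
      by (simp add: order.strict_trans1[OF order.trans[OF dim_le_card' card_image_le]])
    then obtain x0 where x0: "x0 \<noteq> 0" "\<And>y. y \<in> span ((\<lambda>j. M *v b j) ` I) \<Longrightarrow> orthogonal x0 y"
      using orthogonal_to_subspace_exists by metis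
    then have x0V: "x0 \<in> V"
      by (auto simp: V_def orthogonal_def span_base)
    define S where "S = V \<inter> sphere 0 1"
    have "compact S"
      unfolding S_def by (intro closed_Int_compact closed_subspace V) simp
    moreover have "x0 /\<^sub>R norm x0 \<in> S"
      using x0 x0V V by (simp add: S_def subspace_scale)
    moreover have "continuous_on S (\<lambda>x. (x \<bullet> (N *v x)) / (x \<bullet> (M *v x)))"
    proof (intro continuous_intros ballI)
      fix x assume "x \<in> S"
      then have "x \<noteq> 0" by (auto simp: S_def)
      from pd[OF this] show "x \<bullet> (M *v x) \<noteq> 0" by simp
    qed
    ultimately obtain c where c: "c \<in> S"
      and cmax: "\<And>y. y \<in> S \<Longrightarrow> (y \<bullet> (N *v y)) / (y \<bullet> (M *v y)) \<le> (c \<bullet> (N *v c)) / (c \<bullet> (M *v c))"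
      using continuous_attains_sup[of S] by blast
    define \<mu> where "\<mu> = (c \<bullet> (N *v c)) / (c \<bullet> (M *v c))"
    have cV: "c \<in> V" and c0: "c \<noteq> 0" using c by (auto simp: S_def)
    \<comment> \<open>Maximality of \<open>\<mu>\<close> makes the form of \<open>A\<close>
      nonnegative on \<open>V\<close> with a zero at \<open>c\<close>, so \<open>A *v c\<close> is
      orthogonal to \<open>V\<close> by \<open>psd_form_null\<close>. For the vectors
      \<open>b j\<close> the same follows from symmetry and the eigenvalue equation. Hence
      \<open>A *v c = 0\<close>.\<close>
    define A where "A = \<mu> *\<^sub>R M - N"
    have Av: "A *v x = \<mu> *\<^sub>R (M *v x) - N *v x" for x
      by (simp add: A_def matrix_vector_mult_diff_rdistrib scaleR_matrix_vector_assoc)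
    have symA: "transpose A = A"
      using symM symN by (simp add: A_def transpose_def vec_eq_iff)
    have psd: "0 \<le> y \<bullet> (A *v y)" if "y \<in> V" for y
    proof (cases "y = 0")
      case False
      define z where "z = y /\<^sub>R norm y"
      have "z \<in> S" using that False V by (simp add: S_def z_def subspace_scale)
      moreover have "0 < z \<bullet> (M *v z)" using pd[of z] False by (simp add: z_def)
      ultimately have "z \<bullet> (N *v z) \<le> \<mu> * (z \<bullet> (M *v z))"
        using cmax[of z] by (simp add: \<mu>_def[symmetric] pos_divide_le_eq)
      then have "0 \<le> z \<bullet> (A *v z)"
        by (simp add: Av inner_diff_right)
      moreover have "y \<bullet> (A *v y) = (norm y)\<^sup>2 * (z \<bullet> (A *v z))"
        using False by (simp add: z_def matrix_vector_mult_scaleR power2_eq_square field_simps)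
      ultimately show ?thesis by simp
    qed simp
    have cAc: "c \<bullet> (A *v c) = 0"
      using pd[OF c0] by (simp add: Av inner_diff_right \<mu>_def)
    have Ac: "A *v c = 0"
    proof -
      have "x \<bullet> (A *v c) = 0" for x
      proof -
        \<comment> \<open>The \<open>M\<close>-orthogonal projection of \<open>x\<close> to
          \<open>V\<close>.\<close>
        define v where "v = x - (\<Sum>j\<in>I. (x \<bullet> (M *v b j)) *\<^sub>R b j)"
        have "v \<bullet> (M *v b j) = 0" if j: "j \<in> I" for j
        proof -
          have "(\<Sum>i\<in>I. (x \<bullet> (M *v b i)) *\<^sub>R b i) \<bullet> (M *v b j) =
              (\<Sum>i\<in>I. if i = j then x \<bullet> (M *v b j) else 0)"
            unfolding inner_sum_left by (rule sum.cong) (use j in \<open>auto simp: orth\<close>)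
          then show ?thesis
            using j insert.hyps by (simp add: v_def inner_diff_left)
        qed
        then have "v \<in> V" by (simp add: V_def)
        then have "v \<bullet> (A *v c) = 0"
          using psd_form_null[OF symA V cV _ psd cAc] by blast
        moreover have "b j \<bullet> (A *v c) = 0" if "j \<in> I" for j
        proof -
          have "b j \<bullet> (A *v c) = c \<bullet> (A *v b j)" by (rule sym_matrix_dot[OF symA])
          also have "\<dots> = 0" using that cV by (simp add: Av eig inner_diff_right V_def)
          finally show ?thesis .
        qed
        moreover have "x \<bullet> (A *v c) =
            v \<bullet> (A *v c) + (\<Sum>j\<in>I. (x \<bullet> (M *v b j)) * (b j \<bullet> (A *v c)))"
          by (simp add: v_def inner_diff_left inner_sum_left)
        ultimately show ?thesis by simp
      qed
      from this[of "A *v c"] show ?thesis by simp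
    qed
    define s where "s = sqrt (c \<bullet> (M *v c))"
    have s: "0 < s" "s * s = c \<bullet> (M *v c)" using pd[OF c0] by (auto simp: s_def)
    define b' where "b' = b(k := c /\<^sub>R s)"
    have "b' i \<bullet> (M *v b' j) = (if i = j then 1 else 0)" if "i \<in> insert k I" "j \<in> insert k I" for i j
      using that insert.hyps orth cV s sym_matrix_dot[OF symM, of c "b j"]
       sym_matrix_dot[OF symM, of c "b i"]
      by (auto simp: b'_def V_def matrix_vector_mult_scaleR divide_simps)
    moreover have "N *v b' i = (ev(k := \<mu>)) i *\<^sub>R (M *v b' i)" if "i \<in> insert k I" for i
    proof -
      have "N *v c = \<mu> *\<^sub>R (M *v c)" using Ac by (simp add: Av)
      then show ?thesis using that insert.hyps eig by (auto simp: b'_def matrix_vector_mult_scaleR)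
    qed
    ultimately show ?case by blast
  qed
qed

text \<open>The columns of \<open>P\<close> are a full generalized eigenbasis. The third conclusion
  exhibits the eigenvalues as values of the form of \<open>N\<close>, which gives their
  sign.\<close>

lemma simultaneous_diagonalization:
  fixes M N :: "real^'m^'m"
  assumes "transpose M = M" "transpose N = N" "\<And>x. x \<noteq> 0 \<Longrightarrow> 0 < x \<bullet> (M *v x)"
  obtains P :: "real^'m^'m" and ev where "transpose P ** M ** P = mat 1"
    "transpose P ** N ** P = (\<chi> i j. if i = j then ev i else 0)"
    "\<And>i. ev i = column i P \<bullet> (N *v column i P)"
proof -
  obtain b :: "'m \<Rightarrow> real^'m" and ev where b: "\<And>i j. b i \<bullet> (M *v b j) = (if i = j then 1 else 0)"
    "\<And>i. N *v b i = ev i *\<^sub>R (M *v b i)"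
    using generalized_eigenbasis[OF assms, of UNIV] by auto
  define P :: "real^'m^'m" where "P = (\<chi> i j. b j $ i)"
  have col: "column j P = b j" for j by (simp add: P_def column_def)
  have form: "(transpose P ** A ** P) $ i $ j = b i \<bullet> (A *v b j)" for A i j
  proof -
    have "(transpose P ** A ** P) $ i $ j = (transpose P ** (A ** P)) $ i $ j"
      by (simp add: matrix_mul_assoc)
    also have "\<dots> = b i \<bullet> (A *v b j)"
      by (simp add: matrix_matrix_mult_def transpose_def P_def inner_vec_def matrix_vector_mult_def)
    finally show ?thesis .
  qed
  show thesis
  proof
    show "transpose P ** M ** P = mat 1" by (simp add: vec_eq_iff form b mat_def)
    show "transpose P ** N ** P = (\<chi> i j. if i = j then ev i else 0)"
      by (simp add: vec_eq_iff form b)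
    show "ev i = column i P \<bullet> (N *v column i P)" for i by (simp add: col b)
  qed
qed

text \<open>Diagonalizing \<open>M\<close> relative to itself gives
  \<open>det M * (det P)\<^sup>2 = 1\<close>.\<close>

lemma det_pos_definite:
  fixes M :: "real^'m^'m"
  assumes "transpose M = M" "\<And>x. x \<noteq> 0 \<Longrightarrow> 0 < x \<bullet> (M *v x)"
  shows "0 < det M"
proof -
  obtain P :: "real^'m^'m" where "transpose P ** M ** P = mat 1"
    using simultaneous_diagonalization[OF assms(1,1,2)] by metis
  then have "det P * det M * det P = 1"
    by (metis det_I det_mul det_transpose)
  then have "det M * (det P)\<^sup>2 = 1" by (simp add: power2_eq_square mult_ac)
  then show ?thesis by (metis zero_less_mult_iff zero_less_one zero_le_power2 not_less)
qed

text \<open>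
  Simultaneous diagonalization reduces this to \<open>\<lambda> \<le> exp (\<lambda> - 1)\<close> for each eigenvalue \<open>\<lambda>\<close> of \<open>N\<close>
  relative to \<open>M\<close>; it plays the role of the concavity of \<open>ln det\<close>.
\<close>

lemma det_le_exp_trace:
  fixes M N B :: "real^'m^'m"
  assumes "transpose M = M" "transpose N = N"
    and "\<And>x. x \<noteq> 0 \<Longrightarrow> 0 < x \<bullet> (M *v x)"
    and psd: "\<And>x. 0 \<le> x \<bullet> (N *v x)" and inv: "B ** M = mat 1"
  shows "det N \<le> det M * exp (trace (B ** N) - real CARD('m))"
proof -
  obtain P :: "real^'m^'m" and ev where P: "transpose P ** M ** P = mat 1"
    "transpose P ** N ** P = (\<chi> i j. if i = j then ev i else 0)"
    "\<And>i. ev i = column i P \<bullet> (N *v column i P)"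
    using simultaneous_diagonalization[OF assms(1-3)] by blast
  \<comment> \<open>A one-sided inverse of a square matrix is two-sided, so
    \<open>P ** transpose P\<close> is the inverse of \<open>M\<close>. Thus the trace of
    \<open>B ** N\<close> is the sum of the eigenvalues.\<close>
  have "P ** (transpose P ** M) = mat 1"
    using P(1) by (metis matrix_left_right_inverse)
  then have B: "B = P ** transpose P"
    using inv by (metis matrix_left_right_inverse matrix_mul_assoc matrix_mul_lid matrix_mul_rid)
  have "trace (B ** N) = trace (transpose P ** N ** P)"
    by (metis B matrix_mul_assoc trace_mul_sym)
  also have "\<dots> = (\<Sum>i\<in>UNIV. ev i)" by (simp add: P(2) trace_def)
  finally have tr: "trace (B ** N) - real CARD('m) = (\<Sum>i\<in>UNIV. ev i - 1)"
    by (simp add: sum_subtractf)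
  have "det P * det M * det P = 1"
    by (metis P(1) det_I det_mul det_transpose)
  then have dM: "det M * (det P)\<^sup>2 = 1" by (simp add: power2_eq_square mult_ac)
  have dM0: "0 < det M" using assms(1,3) by (rule det_pos_definite)
  have "det N * (det P)\<^sup>2 = det (transpose P ** N ** P)"
    by (simp add: det_mul power2_eq_square mult_ac)
  also have "\<dots> = (\<Prod>i\<in>UNIV. ev i)" unfolding P(2) by (subst det_diagonal) auto
  also have "\<dots> \<le> (\<Prod>i\<in>UNIV. exp (ev i - 1))"
  proof (rule prod_mono)
    fix i
    show "0 \<le> ev i \<and> ev i \<le> exp (ev i - 1)"
      using psd P(3)[of i] exp_ge_add_one_self[of "ev i - 1"] by simp
  qed
  also have "\<dots> = exp (trace (B ** N) - real CARD('m))" by (simp add: tr exp_sum)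
  finally have "det M * (det N * (det P)\<^sup>2) \<le> det M * exp (trace (B ** N) - real CARD('m))"
    using dM0 by simp
  moreover have "det M * (det N * (det P)\<^sup>2) = det N"
    using dM by (metis mult.left_commute mult.right_neutral)
  ultimately show ?thesis by simp
qed

section \<open>Rank-one matrices and determinants of rank-one updates\<close>

definition outer :: "real^'m \<Rightarrow> real^'m \<Rightarrow> real^'m^'m" where
  "outer a b = (\<chi> i j. a $ i * b $ j)"

lemma outer_mult_vec: "outer a b *v x = (b \<bullet> x) *\<^sub>R a"
  by (simp add: outer_def vec_eq_iff matrix_vector_mult_def inner_vec_def sum_distrib_left mult_ac)

lemma matrix_mult_outer: "A ** outer a b = outer (A *v a) b"
  by (simp add: outer_def vec_eq_iff matrix_matrix_mult_def matrix_vector_mult_def sum_distrib_left mult_ac)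

lemma matrix_add_rdistrib: "((A :: real^'n^'m) + B) ** C = A ** C + B ** C"
  by (simp add: vec_eq_iff matrix_matrix_mult_def sum.distrib algebra_simps)

text \<open>
  A rotation takes \<open>b\<close> to a multiple of an axis, so that only one column differs from the identity
  and Cramer's lemma applies.
\<close>

lemma det_mat1_outer:
  fixes a b :: "real^'m"
  shows "det (mat 1 + outer a b) = 1 + a \<bullet> b"
proof -
  obtain k :: 'm where True by simp
  obtain g :: "real^'m \<Rightarrow> real^'m" where g: "orthogonal_transformation g" "g b = norm b *\<^sub>R axis k 1"
    by (rule orthogonal_transformation_exists[of b "norm b *\<^sub>R axis k 1"]) auto
  define R where "R = matrix g"
  have R: "orthogonal_matrix R" using g(1) by (simp add: R_def orthogonal_transformation_matrix)
  have Rv: "R *v x = g x" for x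
    using g(1) by (simp add: R_def matrix_works orthogonal_transformation_linear)
  define u where "u = norm b *\<^sub>R (R *v a)"
  have "R ** (mat 1 + outer a b) ** transpose R = mat 1 + R ** outer a b ** transpose R"
    using R by (simp add: matrix_add_ldistrib matrix_add_rdistrib orthogonal_matrix_def)
  also have "R ** outer a b ** transpose R = outer (R *v a) (R *v b)"
    by (simp add: matrix_mult_outer) (simp add: outer_def vec_eq_iff matrix_matrix_mult_def
        matrix_vector_mult_def transpose_def sum_distrib_left mult_ac)
  also have "\<dots> = outer u (axis k 1)"
    by (simp add: Rv g(2) u_def outer_def vec_eq_iff mult_ac)
  \<comment> \<open>The shape of \<open>cramer_lemma\<close>: its value is the \<open>k\<close>-th
    entry of \<open>axis k 1 + u\<close> times the determinant of the identity.\<close>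
  also have "mat 1 + outer u (axis k 1) =
      (\<chi> i j. if j = k then (mat 1 *v (axis k 1 + u)) $ i else mat 1 $ i $ j)"
    unfolding matrix_vector_mul_lid by (auto simp: outer_def vec_eq_iff mat_def axis_def)
  finally have "det (R ** (mat 1 + outer a b) ** transpose R) = 1 + u $ k"
    by (simp only: cramer_lemma) simp
  moreover have "det (R ** (mat 1 + outer a b) ** transpose R) = det (mat 1 + outer a b)"
  proof -
    have "det R * det R = 1"
      using R by (metis det_mul det_transpose orthogonal_matrix_def det_I)
    then show ?thesis by (simp add: det_mul)
  qed
  moreover have "u $ k = a \<bullet> b"
  proof -
    have "a \<bullet> b = g a \<bullet> g b" using g(1) by (simp add: orthogonal_transformation_def)
    then show ?thesis by (simp add: g(2) u_def Rv inner_axis)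
  qed
  ultimately show ?thesis by simp
qed

text \<open>The first update \<open>A\<close> is non-singular by hypothesis and factors out: with
  \<open>A *v c = b\<close> the matrix is \<open>A ** (mat 1 + outer c v)\<close>, and
  \<open>det_mat1_outer\<close> applies to both factors.\<close>

lemma det_mat1_outer_outer:
  fixes a b u v :: "real^'m"
  assumes "1 + a \<bullet> u \<noteq> 0"
  shows "det (mat 1 + outer a u + outer b v) = (1 + a \<bullet> u) * (1 + b \<bullet> v) - (b \<bullet> u) * (a \<bullet> v)"
proof -
  define A where "A = mat 1 + outer a u"
  \<comment> \<open>This is the inverse of \<open>A\<close> applied to \<open>b\<close>, by the
    Sherman-Morrison formula.\<close>
  define c where "c = b - ((b \<bullet> u) / (1 + a \<bullet> u)) *\<^sub>R a"
  have "A *v c = b"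
  proof -
    have "A *v c = c + (u \<bullet> c) *\<^sub>R a"
      by (simp add: A_def matrix_vector_mult_add_rdistrib outer_mult_vec)
    also have "\<dots> = b + (u \<bullet> c - (b \<bullet> u) / (1 + a \<bullet> u)) *\<^sub>R a"
      by (simp add: c_def scaleR_diff_left)
    also have "u \<bullet> c = (b \<bullet> u) / (1 + a \<bullet> u)"
      using assms by (simp add: c_def inner_diff_right inner_commute[of u] field_simps)
    finally show ?thesis by simp
  qed
  then have "A ** (mat 1 + outer c v) = mat 1 + outer a u + outer b v"
    by (simp add: matrix_add_ldistrib matrix_mult_outer A_def)
  then have "det (mat 1 + outer a u + outer b v) = det A * det (mat 1 + outer c v)"
    by (metis det_mul)
  also have "\<dots> = (1 + a \<bullet> u) * (1 + b \<bullet> v - (b \<bullet> u) / (1 + a \<bullet> u) * (a \<bullet> v))"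
    by (simp add: A_def det_mat1_outer c_def inner_diff_left)
  also have "\<dots> = (1 + a \<bullet> u) * (1 + b \<bullet> v) - (b \<bullet> u) * (a \<bullet> v)"
    using assms by (simp add: field_simps)
  finally show ?thesis .
qed

subsection \<open>Information matrices and the variance function\<close>

lemma info_matrix_outer: "info_matrix f w = (\<Sum>x\<in>UNIV. w $ x *\<^sub>R outer (f x) (f x))"
  by (simp add: info_matrix_def outer_def columnvector_def rowvector_def matrix_matrix_mult_def)

lemma transpose_info_matrix: "transpose (info_matrix f w) = info_matrix f w"
  by (simp add: info_matrix_outer transpose_def vec_eq_iff outer_def mult_ac)

lemma sum_matrix_vector_mult: "sum A S *v (x :: real^'n) = (\<Sum>i\<in>S. A i *v x)"
  for A :: "'i \<Rightarrow> real^'n^'m"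
  by (induction S rule: infinite_finite_induct) (simp_all add: matrix_vector_mult_add_rdistrib)

lemma info_matrix_mult_vec: "info_matrix f w *v y = (\<Sum>x\<in>UNIV. (w $ x * (f x \<bullet> y)) *\<^sub>R f x)"
  by (simp add: info_matrix_outer sum_matrix_vector_mult outer_mult_vec
      flip: scaleR_matrix_vector_assoc)

lemma info_matrix_form: "y \<bullet> (info_matrix f w *v y) = (\<Sum>x\<in>UNIV. w $ x * (f x \<bullet> y)\<^sup>2)"
  by (simp add: info_matrix_mult_vec inner_sum_right inner_commute power2_eq_square mult_ac)

lemma info_matrix_psd: "w \<in> designs \<Longrightarrow> 0 \<le> y \<bullet> (info_matrix f w *v y)"
  by (simp add: info_matrix_form designs_def sum_nonneg)

text \<open>A zero of this sum of nonnegative terms makes every term vanish, which puts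
  \<open>y\<close> into the kernel of the invertible matrix.\<close>

lemma info_matrix_pd:
  assumes "w \<in> regular_designs f" "y \<noteq> 0"
  shows "0 < y \<bullet> (info_matrix f w *v y)"
proof (rule ccontr)
  assume "\<not> ?thesis"
  with assms have "(\<Sum>x\<in>UNIV. w $ x * (f x \<bullet> y)\<^sup>2) = 0"
    using info_matrix_psd[of w y f] by (simp add: info_matrix_form regular_designs_def)
  then have null: "w $ x * (f x \<bullet> y) = 0" for x
    using assms by (subst (asm) sum_nonneg_eq_0_iff) (auto simp: regular_designs_def designs_def)
  have "info_matrix f w *v y = 0"
    by (simp only: info_matrix_mult_vec null) simp
  then show False
    using assms by (auto simp: regular_designs_def invertible_left_inverse matrix_left_invertible_ker)
qed

text \<open>Reduces the preservation of regularity to the growth of the determinant.\<close>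

lemma regular_designs_iff_det: "w \<in> regular_designs f \<longleftrightarrow> w \<in> designs \<and> 0 < det (info_matrix f w)"
  using det_pos_definite[OF transpose_info_matrix info_matrix_pd]
  by (auto simp: regular_designs_def invertible_det_nz)

lemma det_info_matrix_nonneg: "w \<in> designs \<Longrightarrow> 0 \<le> det (info_matrix f w)"
  using regular_designs_iff_det[of w f] by (force simp: regular_designs_def invertible_det_nz)

lemma matrix_inv_info_matrix:
  assumes "w \<in> regular_designs f"
  shows "info_matrix f w ** matrix_inv (info_matrix f w) = mat 1"
    and "matrix_inv (info_matrix f w) ** info_matrix f w = mat 1"
proof -
  have "\<exists>A'. info_matrix f w ** A' = mat 1 \<and> A' ** info_matrix f w = mat 1"
    using assms by (simp add: regular_designs_def invertible_def)
  from someI_ex[OF this]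
  show "info_matrix f w ** matrix_inv (info_matrix f w) = mat 1"
    and "matrix_inv (info_matrix f w) ** info_matrix f w = mat 1"
    by (simp_all add: matrix_inv_def)
qed

text \<open>Substituting \<open>y = M z\<close> turns the form of the inverse at \<open>y\<close>
  into the form of \<open>M\<close> at \<open>z\<close>.\<close>

lemma matrix_inv_form_pos:
  assumes "w \<in> regular_designs f" "y \<noteq> 0"
  shows "0 < y \<bullet> (matrix_inv (info_matrix f w) *v y)"
proof -
  define z where "z = matrix_inv (info_matrix f w) *v y"
  have y: "y = info_matrix f w *v z"
    by (simp add: z_def matrix_vector_mul_assoc matrix_inv_info_matrix[OF assms(1)])
  then have "z \<noteq> 0" using assms(2) by auto
  from info_matrix_pd[OF assms(1) this] show ?thesis
    by (metis y z_def inner_commute)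
qed

lemma transpose_matrix_inv_info:
  assumes "w \<in> regular_designs f"
  shows "transpose (matrix_inv (info_matrix f w)) = matrix_inv (info_matrix f w)"
proof -
  have "transpose (matrix_inv (info_matrix f w)) ** info_matrix f w = mat 1"
    by (metis assms matrix_inv_info_matrix(1) matrix_transpose_mul transpose_info_matrix transpose_mat)
  then show ?thesis
    by (metis assms matrix_inv_info_matrix(1) matrix_mul_assoc matrix_mul_lid matrix_mul_rid)
qed

lemma covar_commute: "w \<in> regular_designs f \<Longrightarrow> covar f w u v = covar f w v u"
  unfolding covar_def by (intro sym_matrix_dot transpose_matrix_inv_info)

lemma var_pos: "w \<in> regular_designs f \<Longrightarrow> f u \<noteq> 0 \<Longrightarrow> 0 < var f w u"
  unfolding covar_def by (rule matrix_inv_form_pos)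

lemma var_nonneg: "w \<in> regular_designs f \<Longrightarrow> 0 \<le> var f w u"
  by (cases "f u = 0") (simp_all add: var_pos less_imp_le, simp add: covar_def)

section \<open>Traces and weighted means of the variance function\<close>

lemma trace_outer: "trace (outer a b) = b \<bullet> a"
  by (simp add: trace_def outer_def inner_vec_def mult.commute)

lemma trace_sum: "trace (sum A S) = (\<Sum>i\<in>S. trace (A i))" for A :: "'i \<Rightarrow> real^'m^'m"
  unfolding trace_def sum_component by (rule sum.swap)

lemma matrix_mult_sum: "B ** sum A S = (\<Sum>i\<in>S. B ** A i)"
  for B :: "real^'m^'k" and A :: "'i \<Rightarrow> real^'n^'m"
  by (induction S rule: infinite_finite_induct) (simp_all add: matrix_add_ldistrib)

lemma matrix_mult_scaleR_right: "B ** (c *\<^sub>R A) = c *\<^sub>R (B ** A)"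
  for B :: "real^'m^'k" and A :: "real^'n^'m"
  by (simp add: vec_eq_iff matrix_matrix_mult_def sum_distrib_left mult_ac)

lemma trace_matrix_inv_info:
  "trace (matrix_inv (info_matrix f w) ** info_matrix f v) = (\<Sum>x\<in>UNIV. v $ x * var f w x)"
proof -
  let ?B = "matrix_inv (info_matrix f w)"
  have "?B ** info_matrix f v = (\<Sum>x\<in>UNIV. v $ x *\<^sub>R outer (?B *v f x) (f x))"
    unfolding info_matrix_outer matrix_mult_sum matrix_mult_scaleR_right matrix_mult_outer ..
  then have "trace (?B ** info_matrix f v) = (\<Sum>x\<in>UNIV. trace (v $ x *\<^sub>R outer (?B *v f x) (f x)))"
    by (simp add: trace_sum)
  also have "\<dots> = (\<Sum>x\<in>UNIV. v $ x * trace (outer (?B *v f x) (f x)))"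
    by (simp add: trace_def sum_distrib_left)
  finally show ?thesis by (simp add: trace_outer covar_def)
qed

text \<open>This is the trace of the identity matrix. It places the minimal variance on the support
  at or below m.\<close>

lemma sum_weighted_var:
  fixes f :: "'n::finite \<Rightarrow> real^'m"
  assumes "w \<in> regular_designs f"
  shows "(\<Sum>x\<in>UNIV. w $ x * var f w x) = real CARD('m)"
  using trace_matrix_inv_info[of f w w] by (simp add: matrix_inv_info_matrix[OF assms] trace_I)

text \<open>The exponent in \<open>det_le_exp_trace\<close> is the mean of the variances of
  \<open>w\<close> under the weights \<open>v\<close>, minus m. For an optimal \<open>v\<close> this
  is a quantitative form of the equivalence theorem.\<close>

lemma det_info_matrix_le:
  fixes f :: "'n::finite \<Rightarrow> real^'m"
  assumes w: "w \<in> regular_designs f" and v: "v \<in> designs" and d: "\<And>x. var f w x \<le> d"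
  shows "det (info_matrix f v) \<le> det (info_matrix f w) * exp (d - real CARD('m))"
proof -
  have "(\<Sum>x\<in>UNIV. v $ x * var f w x) \<le> (\<Sum>x\<in>UNIV. v $ x * d)"
    using v d by (intro sum_mono mult_left_mono) (auto simp: designs_def)
  also have "\<dots> = d" using v by (simp add: designs_def flip: sum_distrib_right)
  finally have "exp (trace (matrix_inv (info_matrix f w) ** info_matrix f v) - real CARD('m))
      \<le> exp (d - real CARD('m))"
    by (simp add: trace_matrix_inv_info)
  moreover have "0 < det (info_matrix f w)" using w by (simp add: regular_designs_iff_det)
  ultimately show ?thesis
    using det_le_exp_trace[OF transpose_info_matrix transpose_info_matrix info_matrix_pd[OF w]
        info_matrix_psd[OF v] matrix_inv_info_matrix(2)[OF w]]
    by (meson mult_le_cancel_left_pos order_trans)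
qed

section \<open>The determinant along an exchange\<close>

lemma info_matrix_shift:
  "info_matrix f (w + \<alpha> *\<^sub>R (axis v 1 - axis u 1)) =
    info_matrix f w + \<alpha> *\<^sub>R outer (f v) (f v) - \<alpha> *\<^sub>R outer (f u) (f u)"
proof -
  have "(\<Sum>x\<in>UNIV. (axis z 1 $ x) *\<^sub>R outer (f x) (f x)) = outer (f z) (f z)" for z
    by (subst sum.remove[of _ z]) (auto simp: axis_def intro!: sum.neutral)
  then have ax: "info_matrix f (axis z 1) = outer (f z) (f z)" for z
    by (simp add: info_matrix_outer)
  have "info_matrix f (w + \<alpha> *\<^sub>R (axis v 1 - axis u 1)) =
      info_matrix f w + \<alpha> *\<^sub>R info_matrix f (axis v 1) - \<alpha> *\<^sub>R info_matrix f (axis u 1)"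
    unfolding info_matrix_outer
    by (simp add: scaleR_sum_right sum.distrib sum_subtractf scaleR_add_left scaleR_diff_left
        scaleR_diff_right right_diff_distrib)
  then show ?thesis by (simp add: ax)
qed

text \<open>Factoring out the old matrix leaves the identity plus two rank-one terms. If the
  quadratic coefficient is non-zero, the stationary point in \<alpha> is the unclamped step
  length.\<close>

lemma det_info_matrix_shift:
  fixes f :: "'n::finite \<Rightarrow> real^'m"
  assumes w: "w \<in> regular_designs f"
  shows "det (info_matrix f (w + \<alpha> *\<^sub>R (axis v 1 - axis u 1))) = det (info_matrix f w) *
    (1 + \<alpha> * (var f w v - var f w u) - \<alpha>\<^sup>2 * (var f w u * var f w v - (covar f w u v)\<^sup>2))"
proof -
  let ?M = "info_matrix f w"
  let ?B = "matrix_inv (info_matrix f w)"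
  have MB: "?M *v (?B *v y) = y" for y
    by (simp add: matrix_vector_mul_assoc matrix_inv_info_matrix[OF w])
  have out: "?M ** outer (c *\<^sub>R (?B *v y)) y = c *\<^sub>R outer y y" for c y
    by (simp add: matrix_mult_outer matrix_vector_mult_scaleR MB)
      (simp add: outer_def vec_eq_iff)
  have eq: "info_matrix f (w + \<alpha> *\<^sub>R (axis v 1 - axis u 1)) =
      ?M ** (mat 1 + outer (\<alpha> *\<^sub>R (?B *v f v)) (f v) + outer ((-\<alpha>) *\<^sub>R (?B *v f u)) (f u))"
    unfolding info_matrix_shift matrix_add_ldistrib out by simp
  have d: "(?B *v f x) \<bullet> f y = covar f w y x" for x y
    by (simp add: covar_def inner_commute)
  have "det (mat 1 + outer (\<alpha> *\<^sub>R (?B *v f v)) (f v) + outer ((-\<alpha>) *\<^sub>R (?B *v f u)) (f u)) =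
    (1 + \<alpha> * var f w v) * (1 - \<alpha> * var f w u) + \<alpha>\<^sup>2 * (covar f w u v)\<^sup>2"
    \<comment> \<open>The sign of \<open>\<alpha>\<close> decides which of the two rank-one updates is surely non-singular.\<close>
  proof (cases "0 \<le> \<alpha>")
    case True
    then have "1 + \<alpha> * var f w v \<noteq> 0"
      using var_nonneg[OF w] by (smt (verit) mult_nonneg_nonneg)
    then show ?thesis
      by (subst det_mat1_outer_outer)
        (simp_all add: d covar_commute[OF w, of v u] power2_eq_square mult_ac)
  next
    case False
    then have "1 - \<alpha> * var f w u \<noteq> 0"
      using var_nonneg[OF w] by (smt (verit) mult_nonpos_nonneg)
    \<comment> \<open>The two rank-one terms are swapped, so that the update at \<open>u\<close> is
      the one factored out first.\<close>
    then show ?thesis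
      by (subst add.assoc, subst (2) add.commute, subst add.assoc[symmetric], subst det_mat1_outer_outer)
        (simp_all add: d covar_commute[OF w, of v u] power2_eq_square mult_ac)
  qed
  note D = this
  show ?thesis
    unfolding eq det_mul D by (simp add: algebra_simps power2_eq_square)
qed

subsection \<open>Exchanges\<close>

text \<open>Cauchy-Schwarz for the inner product of the inverse matrix: the difference is
  \<open>var f w v\<close> times the form at the residual \<open>z\<close> of projecting
  \<open>f u\<close> onto \<open>f v\<close>, so it is strict for a non-zero residual.\<close>

lemma covar_sq_le:
  assumes w: "w \<in> regular_designs f" and v: "f v \<noteq> 0"
  shows "0 \<le> var f w u * var f w v - (covar f w u v)\<^sup>2"
    and "f u \<noteq> (covar f w u v / var f w v) *\<^sub>R f v \<Longrightarrow>
      0 < var f w u * var f w v - (covar f w u v)\<^sup>2"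
proof -
  let ?B = "matrix_inv (info_matrix f w)"
  define c where "c = covar f w u v / var f w v"
  define z where "z = f u - c *\<^sub>R f v"
  have dv: "0 < var f w v" using w v by (rule var_pos)
  have vu: "f v \<bullet> (?B *v f u) = covar f w u v"
    using covar_commute[OF w, of v u] by (simp add: covar_def)
  have "z \<bullet> (?B *v z) = var f w u - 2 * c * covar f w u v + c\<^sup>2 * var f w v"
    by (simp add: z_def matrix_vector_mult_diff_distrib matrix_vector_mult_scaleR inner_diff_left
        inner_diff_right vu) (simp add: covar_def power2_eq_square algebra_simps)
  then have eq: "var f w u * var f w v - (covar f w u v)\<^sup>2 = var f w v * (z \<bullet> (?B *v z))"
    using dv by (simp add: c_def power2_eq_square field_simps)
  show "0 < var f w u * var f w v - (covar f w u v)\<^sup>2"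
    if "f u \<noteq> (covar f w u v / var f w v) *\<^sub>R f v"
    using matrix_inv_form_pos[OF w, of z] that dv by (simp add: eq z_def c_def)
  show "0 \<le> var f w u * var f w v - (covar f w u v)\<^sup>2"
    using matrix_inv_form_pos[OF w, of z] dv unfolding eq
    by (cases "z = 0") (auto simp: less_imp_le)
qed

lemma indep_pairD:
  assumes "indep_pair a b" shows "a \<noteq> c *\<^sub>R b"
proof
  assume "a = c *\<^sub>R b"
  then have "a \<in> span {b}" by (simp add: span_base span_scale)
  then show False using assms by (simp add: indep_pair_def independent_insert)
qed

lemma not_indep_pairD:
  assumes "\<not> indep_pair a b" "b \<noteq> 0"
  obtains c where "a = c *\<^sub>R b"
proof (cases "a = b")
  case True
  then show ?thesis using that[of 1] by simp
next
  case False
  then have "a \<in> span {b}" using assms by (simp add: indep_pair_def independent_insert)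
  then show ?thesis using that by (auto simp: span_singleton)
qed

text \<open>Equality in Cauchy-Schwarz: for dependent regressors the determinant is affine in
  \<alpha>, which is why the step length rule jumps to an endpoint when the variances
  differ.\<close>

lemma covar_sq_eq:
  assumes "w \<in> regular_designs f" "f v \<noteq> 0" "\<not> indep_pair (f u) (f v)"
  shows "var f w u * var f w v - (covar f w u v)\<^sup>2 = 0"
proof -
  obtain c where "f u = c *\<^sub>R f v" using not_indep_pairD assms(2,3) by blast
  then show ?thesis by (simp add: covar_def matrix_vector_mult_scaleR power2_eq_square)
qed

section \<open>Exchanged designs and their determinants\<close>

lemma step_length_bounds:
  assumes "w \<in> designs"
  shows "- (w $ v) \<le> step_length f w u v" "step_length f w u v \<le> w $ u"
  using assms by (auto simp: step_length_def designs_def min_def max_def; smt (verit))+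

lemma exchange_same: "exchange f w u u = w"
  by (simp add: exchange_def)

lemma exchange_nth:
  assumes "u \<noteq> v"
  shows "exchange f w u v $ x = (if x = u then w $ u - step_length f w u v
    else if x = v then w $ v + step_length f w u v else w $ x)"
  using assms by (auto simp: exchange_def axis_def)

lemma exchange_in_designs:
  fixes f :: "'n::finite \<Rightarrow> real ^ 'm"
  assumes "w \<in> designs"
  shows "exchange f w u v \<in> designs"
proof (cases "u = v")
  case False
  have "0 \<le> exchange f w u v $ x" for x
    using assms step_length_bounds[OF assms, where v=v and u=u and f=f]
    by (simp add: exchange_nth[OF False] designs_def)
  moreover have "(\<Sum>x\<in>UNIV. exchange f w u v $ x) = (\<Sum>x\<in>UNIV. w $ x)"
  proof -
    have ax: "(\<Sum>x\<in>UNIV. axis z (1::real) $ x) = 1" for z :: 'n by (simp add: axis_def)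
    show ?thesis by (simp add: exchange_def sum.distrib sum_subtractf ax flip: sum_distrib_left)
  qed
  ultimately show ?thesis using assms by (simp add: designs_def)
qed (simp add: exchange_same assms)

text \<open>
  The relative gain is \<open>\<alpha> b - \<alpha>\<^sup>2 Q\<close> with \<open>b = d\<^sub>v - d\<^sub>u\<close>. As the step length lies between \<open>0\<close> and the
  maximizer \<open>b / (2 Q)\<close>, this is at least \<open>\<alpha> b / 2\<close>.
\<close>

lemma det_exchange_ge:
  fixes f :: "'n::finite \<Rightarrow> real ^ 'm" and u v :: 'n
  assumes w: "w \<in> regular_designs f" and v: "f v \<noteq> 0"
  defines "g \<equiv> step_length f w u v * (var f w v - var f w u)"
  shows "0 \<le> g" and "det (info_matrix f w) * (1 + g / 2) \<le> det (info_matrix f (exchange f w u v))"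
proof -
  define a b Q where "a = step_length f w u v" and "b = var f w v - var f w u"
    and "Q = var f w u * var f w v - (covar f w u v)\<^sup>2"
  have wd: "0 \<le> w $ u" "0 \<le> w $ v" using w by (auto simp: regular_designs_def designs_def)
  have Q: "0 \<le> Q" unfolding Q_def by (rule covar_sq_le[OF w v])
  have "0 \<le> a * b \<and> a\<^sup>2 * Q \<le> a * b / 2"
  \<comment> \<open>In the degenerate cases the quadratic term vanishes: two zero weights give
    \<open>a = 0\<close>, dependent regressors give \<open>Q = 0\<close>.\<close>
  proof (cases "(w $ u = 0 \<and> w $ v = 0) \<or> \<not> indep_pair (f u) (f v)")
    case True
    then have "Q = 0 \<or> a = 0"
      using covar_sq_eq[where f=f and u=u, OF w v] by (auto simp: Q_def a_def step_length_def)
    moreover have "0 \<le> a * b"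
      using True wd by (auto simp: a_def b_def step_length_def mult_nonneg_nonneg mult_nonpos_nonpos)
    ultimately show ?thesis by auto
  next
    case False
    then have Q: "0 < Q"
      unfolding Q_def using indep_pairD by (intro covar_sq_le(2)[OF w v]) blast
    define t where "t = b / (2 * Q)"
    have b: "b = 2 * Q * t" using Q by (simp add: t_def)
    have a: "a = min (w $ u) (max (- (w $ v)) t)"
      using False by (simp add: a_def step_length_def t_def b_def Q_def)
    \<comment> \<open>The clamping interval contains 0, so clamping moves \<open>t\<close> towards 0
      without changing its sign.\<close>
    have "a * a \<le> a * t \<and> 0 \<le> a * t"
    proof (cases "0 \<le> t")
      case True
      then have "0 \<le> a" "a \<le> t" using a wd by auto
      then show ?thesis by (simp add: mult_left_mono)
    next
      case False
      then have "a \<le> 0" "t \<le> a" using a wd by auto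
      then show ?thesis by (simp add: mult_left_mono_neg mult_nonpos_nonpos)
    qed
    then have "Q * (a * a) \<le> Q * (a * t)" "0 \<le> Q * (a * t)" using Q by simp_all
    then show ?thesis unfolding b power2_eq_square by (simp add: mult_ac)
  qed
  then have *: "0 \<le> a * b" "a * b / 2 \<le> a * b - a\<^sup>2 * Q" by simp_all
  then show "0 \<le> g" by (simp add: g_def a_def b_def)
  have "0 \<le> det (info_matrix f w)" using w by (simp add: regular_designs_iff_det)
  then have "det (info_matrix f w) * (1 + a * b / 2) \<le> det (info_matrix f w) * (1 + a * b - a\<^sup>2 * Q)"
    using * by (intro mult_left_mono) auto
  then show "det (info_matrix f w) * (1 + g / 2) \<le> det (info_matrix f (exchange f w u v))"
    unfolding exchange_def det_info_matrix_shift[OF w] by (simp add: a_def b_def Q_def g_def)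
qed

lemma exchange_regular:
  assumes w: "w \<in> regular_designs f" and v: "f v \<noteq> 0"
  shows "exchange f w u v \<in> regular_designs f"
    and "det (info_matrix f w) \<le> det (info_matrix f (exchange f w u v))"
proof -
  have pos: "0 < det (info_matrix f w)" using w by (simp add: regular_designs_iff_det)
  show le: "det (info_matrix f w) \<le> det (info_matrix f (exchange f w u v))"
    using det_exchange_ge[OF w v, of u] pos
    by (intro order.trans[OF _ det_exchange_ge(2)[OF w v]]) (simp add: mult_le_cancel_left1)
  show "exchange f w u v \<in> regular_designs f"
    using le pos w by (simp add: regular_designs_iff_det exchange_in_designs)
qed

text \<open>The step is strictly positive, since for independent regressors the unclamped step is.
  This rules out the endpoint \<open>- (w $ l)\<close>.\<close>

lemma nullifying_step_length:
  assumes "w \<in> regular_designs f" "nullifying f w k l" "0 < w $ k" "var f w k < var f w l" "f l \<noteq> 0"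
  shows "step_length f w k l = w $ k"
proof -
  have "0 \<le> w $ l" using assms by (auto simp: regular_designs_def designs_def)
  moreover have "0 < var f w k * var f w l - (covar f w k l)\<^sup>2" if "indep_pair (f k) (f l)"
    using that indep_pairD by (intro covar_sq_le(2)[OF assms(1,5)]) blast
  then have "0 < step_length f w k l"
    using assms by (auto simp: step_length_def less_max_iff_disj)
  ultimately show ?thesis using assms(2) by (auto simp: nullifying_def)
qed

text \<open>Dependent regressors would give the endpoint \<open>w $ k\<close>, so the step is the
  unclamped one; dropping the squared covariance enlarges its denominator.\<close>

lemma not_nullifying_step_length:
  assumes "w \<in> regular_designs f" "\<not> nullifying f w k l" "0 < w $ k" "var f w k < var f w l" "f l \<noteq> 0"
  shows "(var f w l - var f w k) / (2 * (var f w k * var f w l)) \<le> step_length f w k l"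
proof -
  define t where "t = (var f w l - var f w k) / (2 * (var f w k * var f w l - (covar f w k l)\<^sup>2))"
  have ind: "indep_pair (f k) (f l)"
    using assms by (auto simp: nullifying_def step_length_def split: if_splits)
  then have Q: "0 < var f w k * var f w l - (covar f w k l)\<^sup>2"
    using indep_pairD by (intro covar_sq_le(2)[OF assms(1,5)]) blast
  have "step_length f w k l = min (w $ k) (max (- (w $ l)) t)"
    using ind assms(3) by (simp add: step_length_def t_def)
  then have "step_length f w k l = t"
    using assms(2) by (auto simp: nullifying_def min_def max_def split: if_splits)
  moreover have "(var f w l - var f w k) / (2 * (var f w k * var f w l)) \<le> t"
  proof -
    have "0 < var f w k * var f w l" using Q by (smt (verit) zero_le_power2)
    then show ?thesis
      unfolding t_def using Q assms(4) by (intro divide_left_mono[OF _ _ mult_pos_pos]) auto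
  qed
  ultimately show ?thesis by simp
qed

definition weights_separated :: "real \<Rightarrow> real ^ 'n \<Rightarrow> bool" where
  "weights_separated e w \<longleftrightarrow> (\<forall>x. w $ x = 0 \<or> e \<le> w $ x)"

lemma ex_weights_separated: "\<exists>e>0. weights_separated e w" if "w \<in> designs"
proof -
  let ?e = "Min (insert 1 (($) w ` supp w))"
  \<comment> \<open>Inserting 1 keeps the minimum over a non-empty set, whatever the support
    is.\<close>
  have "0 < ?e" by (auto simp: supp_def)
  moreover have "weights_separated ?e w"
    unfolding weights_separated_def
  proof
    fix x show "w $ x = 0 \<or> ?e \<le> w $ x"
      using that by (cases "x \<in> supp w") (auto simp: supp_def designs_def order.antisym not_less)
  qed
  ultimately show ?thesis by blast
qed

text \<open>Either endpoint leaves one of the two points with weight 0 and the other with the sum of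
  both weights.\<close>

lemma weights_separated_exchange:
  assumes "weights_separated e w" "w \<in> designs" "nullifying f w u v"
  shows "weights_separated e (exchange f w u v)"
proof (cases "u = v")
  case False
  have nn: "0 \<le> w $ x" for x using assms(2) by (simp add: designs_def)
  show ?thesis
    unfolding weights_separated_def exchange_nth[OF False]
    using assms(1,3) nn[of u] nn[of v] unfolding weights_separated_def nullifying_def
    by (smt (verit) insert_iff singletonD)
qed (simp add: exchange_same assms)

text \<open>Abstracts from the pair and its place in the permutations, so that all realizations are
  treated alike. The flag is that of the leading exchange.\<close>

definition rex_step :: "('n::finite \<Rightarrow> real ^ 'm) \<Rightarrow> bool \<Rightarrow> real ^ 'n \<Rightarrow> real ^ 'n \<Rightarrow> bool" where
  "rex_step f b w w' \<longleftrightarrow> w' = w \<or> (\<exists>u v. w' = exchange f w u v \<and> (b \<longrightarrow> nullifying f w u v))"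

lemma successively_exchange_pass: "successively (rex_step f b) (w # exchange_pass f b w ps)"
proof (induction ps arbitrary: w)
  case (Cons p ps)
  obtain u v where "p = (u, v)" by force
  then show ?case using Cons by (auto simp: Let_def rex_step_def)
qed simp

text \<open>The leading exchange is itself a step for the flag that it sets, so the whole iteration
  becomes one chain.\<close>

lemma rex_iterationE:
  assumes "rex_iteration f \<gamma> w ws"
  obtains k l where "is_arg_min (var f w) (\<lambda>u. u \<in> supp w) k" "is_arg_max (var f w) (\<lambda>v. v \<in> UNIV) l"
    "hd ws = exchange f w k l" "successively (rex_step f (nullifying f w k l)) (w # ws)"
  using assms
proof cases
  case (1 k l w1 ks ls)
  show thesis
    by (rule that[of k l])
      (use 1 successively_exchange_pass[of f "nullifying f w k l" w1] in \<open>auto simp: rex_step_def\<close>)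
qed

lemma rex_step_regular:
  assumes "rex_step f b w w'" "w \<in> regular_designs f" "\<And>x. f x \<noteq> 0"
  shows "w' \<in> regular_designs f" "det (info_matrix f w) \<le> det (info_matrix f w')"
  using assms exchange_regular[OF assms(2,3)] by (auto simp: rex_step_def)

lemma weights_separated_rex_step:
  assumes "rex_step f True w w'" "w \<in> designs" "weights_separated e w"
  shows "weights_separated e w'"
  using assms weights_separated_exchange by (auto simp: rex_step_def)

section \<open>Existence of a D-optimal design\<close>

lemma compact_designs: "compact (designs :: (real ^ 'n::finite) set)"
proof -
  have "norm w \<le> 1" if "w \<in> designs" for w :: "real ^ 'n"
    using norm_le_l1_cart[of w] that by (simp add: designs_def)
  then have "bounded (designs :: (real ^ 'n) set)" by (auto simp: bounded_iff)
  moreover have "closed (designs :: (real ^ 'n) set)"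
    unfolding designs_def
    by (intro closed_Collect_conj closed_Collect_all closed_Collect_le closed_Collect_eq continuous_intros)
  ultimately show ?thesis by (simp add: compact_eq_bounded_closed)
qed

lemma continuous_det_info_matrix: "continuous_on S (\<lambda>w. det (info_matrix f w))"
  unfolding det_def info_matrix_outer by (intro continuous_intros)

lemma D_criterion_mono:
  fixes A B :: "real^'m^'m"
  assumes "0 \<le> det A" "det A \<le> det B"
  shows "D_criterion A \<le> D_criterion B"
  unfolding D_criterion_def by (rule powr_mono2) (use assms in auto)

text \<open>The determinant is continuous on the compact set of designs, and the criterion is
  monotone in nonnegative determinants.\<close>

lemma ex_max_det:
  fixes f :: "'n::finite \<Rightarrow> real ^ 'm"
  assumes "w0 \<in> (designs :: (real ^ 'n::finite) set)"
  obtains ws where "ws \<in> designs" "\<And>w. w \<in> designs \<Longrightarrow> det (info_matrix f w) \<le> det (info_matrix f ws)"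
    "D_optimal f ws"
proof -
  have "\<exists>ws\<in>designs. \<forall>w\<in>designs. det (info_matrix f w) \<le> det (info_matrix f ws)"
    by (rule continuous_attains_sup[OF compact_designs _ continuous_det_info_matrix]) (use assms in auto)
  then obtain ws where ws: "ws \<in> designs" "\<And>w. w \<in> designs \<Longrightarrow> det (info_matrix f w) \<le> det (info_matrix f ws)"
    by auto
  then have "D_optimal f ws"
    unfolding D_optimal_def is_arg_max_linorder
    by (simp add: D_criterion_mono det_info_matrix_nonneg)
  with ws that show thesis by blast
qed

subsection \<open>Convergence\<close>

text \<open>By \<open>det_exchange_ge\<close> it suffices that step length times variance difference
  is at least \<open>g\<close>. In the non-nullifying case \<open>g\<close> depends only on m and
  \<open>d\<close>.\<close>

lemma leading_exchange_gain:
  fixes f :: "'n::finite \<Rightarrow> real ^ 'm"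
  assumes w: "w \<in> regular_designs f" and f: "\<And>x. f x \<noteq> 0"
    and k: "is_arg_min (var f w) (\<lambda>u. u \<in> supp w) k" and d: "0 < d" "real CARD('m) + d \<le> var f w l"
  defines "g \<equiv> (if nullifying f w k l then w $ k * d else d\<^sup>2 / (2 * real CARD('m) * (real CARD('m) + d)))"
  shows "det (info_matrix f w) * (1 + g / 2) \<le> det (info_matrix f (exchange f w k l))"
proof -
  let ?m = "real CARD('m)"
  define b where "b = var f w l - var f w k"
  have wk: "0 < w $ k" and kmin: "\<And>x. 0 < w $ x \<Longrightarrow> var f w k \<le> var f w x"
    using k by (auto simp: is_arg_min_linorder supp_def)
  have wd: "w \<in> designs" using w by (simp add: regular_designs_def)
  \<comment> \<open>The minimum over the support is at most the weighted mean, which is m.\<close>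
  have "(\<Sum>x\<in>UNIV. w $ x * var f w k) \<le> (\<Sum>x\<in>UNIV. w $ x * var f w x)"
  proof (rule sum_mono)
    fix x
    show "w $ x * var f w k \<le> w $ x * var f w x"
      using wd kmin[of x] by (cases "w $ x = 0") (auto simp: designs_def less_le)
  qed
  then have km: "var f w k \<le> ?m"
    using wd sum_weighted_var[OF w] by (simp add: designs_def flip: sum_distrib_right)
  have k0: "0 < var f w k" using var_pos[OF w f] .
  have m0: "0 < ?m" by simp
  have bd: "d \<le> b" using km d by (simp add: b_def)
  then have kl: "var f w k < var f w l" using d by (simp add: b_def)
  have "g \<le> step_length f w k l * b"
  proof (cases "nullifying f w k l")
    case True
    then show ?thesis
      using nullifying_step_length[OF w True wk kl f] bd wk by (simp add: g_def)
  next
    case False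
    have l0: "0 < var f w l" using k0 kl by simp
    have "d / ?m \<le> b / var f w k"
      by (rule frac_le) (use bd d km k0 in auto)
    \<comment> \<open>Both \<open>b\<close> and \<open>var f w l\<close> grow with the maximal
      variance; writing the quotient as 1 minus \<open>var f w k / var f w l\<close> shows that it
      is increasing.\<close>
    moreover have "d / (?m + d) \<le> b / var f w l"
    proof -
      have "d / (?m + d) = 1 - ?m / (?m + d)" using d m0 by (simp add: field_simps)
      also have "\<dots> \<le> 1 - ?m / var f w l" using d m0 by (simp add: frac_le)
      also have "\<dots> \<le> b / var f w l" using km l0 by (simp add: b_def field_simps)
      finally show ?thesis .
    qed
    ultimately have "(d / ?m) * (d / (?m + d)) / 2 \<le> (b / var f w k) * (b / var f w l) / 2"
      using d m0 k0 l0 bd by (intro divide_right_mono mult_mono) auto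
    then have "g \<le> b / (2 * (var f w k * var f w l)) * b"
      using False by (simp add: g_def power2_eq_square mult_ac)
    also have "\<dots> \<le> step_length f w k l * b"
      using not_nullifying_step_length[OF w False wk kl f] bd d
      unfolding b_def by (intro mult_right_mono) auto
    finally show ?thesis .
  qed
  moreover have "0 < det (info_matrix f w)" using w by (simp add: regular_designs_iff_det)
  ultimately have "det (info_matrix f w) * (1 + g / 2) \<le>
      det (info_matrix f w) * (1 + step_length f w k l * b / 2)"
    by simp
  also have "\<dots> \<le> det (info_matrix f (exchange f w k l))"
    unfolding b_def by (rule det_exchange_ge(2)[OF w f])
  finally show ?thesis .
qed

section \<open>Runs as sequences of steps, and the limit of the determinants\<close>

lemma strict_mono_block:
  fixes T :: "nat \<Rightarrow> nat"
  assumes "strict_mono T" "T 0 = 0"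
  shows "\<exists>i. T i \<le> j \<and> j < T (Suc i)"
proof (induction j)
  case 0
  then show ?case using assms strict_monoD[of T 0 1] by (intro exI[of _ 0]) auto
next
  case (Suc j)
  then obtain i where i: "T i \<le> j" "j < T (Suc i)" by blast
  show ?case
  proof (cases "Suc j < T (Suc i)")
    case False
    then have "T (Suc i) = Suc j" using i by simp
    then show ?thesis using strict_monoD[OF assms(1), of "Suc i" "Suc (Suc i)"]
      by (intro exI[of _ "Suc i"]) auto
  qed (use i in \<open>auto intro: le_SucI\<close>)
qed

lemma rex_runE:
  assumes "rex_run f \<gamma> w0 W"
  obtains T k l where "W 0 = w0" "T 0 = 0" "strict_mono T"
    "\<And>i. is_arg_min (var f (W (T i))) (\<lambda>u. u \<in> supp (W (T i))) (k i)"
    "\<And>i. is_arg_max (var f (W (T i))) (\<lambda>v. v \<in> UNIV) (l i)"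
    "\<And>i. W (Suc (T i)) = exchange f (W (T i)) (k i) (l i)"
    "\<And>i j. T i \<le> j \<Longrightarrow> j < T (Suc i) \<Longrightarrow>
      rex_step f (nullifying f (W (T i)) (k i) (l i)) (W j) (W (Suc j))"
proof -
  obtain T where T: "W 0 = w0" "T 0 = 0" "strict_mono T"
    "\<And>i. rex_iteration f \<gamma> (W (T i)) (map W [Suc (T i)..<Suc (T (Suc i))])"
    using assms by (auto simp: rex_run_def)
  \<comment> \<open>Bundles all facts about iteration \<open>i\<close>, so that a single choice
    yields both functions \<open>k\<close> and \<open>l\<close>.\<close>
  define P where "P i k l \<longleftrightarrow> is_arg_min (var f (W (T i))) (\<lambda>u. u \<in> supp (W (T i))) k \<and>
      is_arg_max (var f (W (T i))) (\<lambda>v. v \<in> UNIV) l \<and>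
      W (Suc (T i)) = exchange f (W (T i)) k l \<and>
      (\<forall>j. T i \<le> j \<longrightarrow> j < T (Suc i) \<longrightarrow> rex_step f (nullifying f (W (T i)) k l) (W j) (W (Suc j)))"
    for i k l
  have "\<exists>k l. P i k l" for i
  proof -
    let ?ws = "map W [Suc (T i)..<Suc (T (Suc i))]"
    have less: "T i < T (Suc i)" using T(3) by (simp add: strict_mono_Suc_iff)
    obtain k l where kl: "is_arg_min (var f (W (T i))) (\<lambda>u. u \<in> supp (W (T i))) k"
      "is_arg_max (var f (W (T i))) (\<lambda>v. v \<in> UNIV) l"
      "hd ?ws = exchange f (W (T i)) k l"
      and succ: "successively (rex_step f (nullifying f (W (T i)) k l)) (W (T i) # ?ws)"
      using T(4)[of i] by (elim rex_iterationE)
    have "W (Suc (T i)) = exchange f (W (T i)) k l"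
      using kl(3) less by (simp add: hd_map upt_conv_Cons del: upt_Suc)
    moreover have "rex_step f (nullifying f (W (T i)) k l) (W j) (W (Suc j))"
      if "T i \<le> j" "j < T (Suc i)" for j
    proof -
      \<comment> \<open>With the initial design in front, the entry at index \<open>j - T i\<close>
        is \<open>W j\<close>.\<close>
      have "W (T i) # ?ws = map W [T i..<Suc (T (Suc i))]"
        using less by (simp add: upt_conv_Cons del: upt_Suc)
      with succ have "successively (rex_step f (nullifying f (W (T i)) k l)) (map W [T i..<Suc (T (Suc i))])"
        by simp
      from successively_nth[OF this, of "j - T i"] show ?thesis
        using that by (simp del: upt_Suc)
    qed
    ultimately have "P i k l" using kl(1,2) by (simp add: P_def)
    then show ?thesis by blast
  qed
  then obtain k l where "\<And>i. P i (k i) (l i)" by metis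
  then show thesis
    by (intro that[of T k l] T) (simp_all add: P_def)
qed

lemma rex_run_det_tendsto:
  fixes f :: "'n::finite \<Rightarrow> real ^ 'm"
  assumes f: "\<And>x. f x \<noteq> 0" and w0: "w0 \<in> regular_designs f" and run: "rex_run f \<gamma> w0 W"
    and ws: "ws \<in> designs" and max: "\<And>w. w \<in> designs \<Longrightarrow> det (info_matrix f w) \<le> det (info_matrix f ws)"
  shows "(\<lambda>i. det (info_matrix f (W i))) \<longlonglongrightarrow> det (info_matrix f ws)"
proof -
  let ?m = "real CARD('m)"
  define D where "D j = det (info_matrix f (W j))" for j
  obtain T k l where W0: "W 0 = w0" and T0: "T 0 = 0" and T: "strict_mono T"
    and k: "\<And>i. is_arg_min (var f (W (T i))) (\<lambda>u. u \<in> supp (W (T i))) (k i)"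
    and l: "\<And>i. is_arg_max (var f (W (T i))) (\<lambda>v. v \<in> UNIV) (l i)"
    and lead: "\<And>i. W (Suc (T i)) = exchange f (W (T i)) (k i) (l i)"
    and run_step: "\<And>i j. T i \<le> j \<Longrightarrow> j < T (Suc i) \<Longrightarrow>
      rex_step f (nullifying f (W (T i)) (k i) (l i)) (W j) (W (Suc j))"
    using rex_runE[OF run] by blast
  have ex_step: "\<exists>b. rex_step f b (W j) (W (Suc j))" for j
    using strict_mono_block[OF T T0, of j] run_step by blast
  have reg: "W j \<in> regular_designs f" for j
  proof (induction j)
    case (Suc j)
    then show ?case using ex_step[of j] rex_step_regular(1) f by blast
  qed (simp add: W0 w0)
  then have des: "W j \<in> designs" for j by (simp add: regular_designs_def)
  have D0: "0 < D 0" using reg[of 0] by (simp add: D_def regular_designs_iff_det)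
  have "D j \<le> D (Suc j)" for j
    using ex_step[of j] rex_step_regular(2)[OF _ reg f] unfolding D_def by blast
  then have inc: "incseq D" by (rule incseq_SucI)
  then obtain L where L: "D \<longlonglongrightarrow> L" and le: "\<And>j. D j \<le> L"
    using incseq_convergent[OF inc, of "det (info_matrix f ws)"] max des by (auto simp: D_def)
  have "L \<le> det (info_matrix f ws)"
    by (rule LIMSEQ_le_const2[OF L]) (use max des in \<open>auto simp: D_def\<close>)
  moreover have "\<not> L < det (info_matrix f ws)"
  proof
    assume less: "L < det (info_matrix f ws)"
    have L0: "0 < L" using D0 le[of 0] by simp
    \<comment> \<open>All determinants are at most \<open>L\<close>, so \<open>d\<close> bounds the
      log-distance to the optimum from below uniformly along the run.\<close>
    define d where "d = ln (det (info_matrix f ws) / L)"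
    have d: "0 < d" using less L0 by (simp add: d_def)
    have gap: "?m + d \<le> var f (W (T i)) (l i)" for i
    proof -
      have "det (info_matrix f ws) \<le> D (T i) * exp (var f (W (T i)) (l i) - ?m)"
        unfolding D_def
        by (rule det_info_matrix_le[OF reg ws]) (use l[of i] in \<open>simp add: is_arg_max_linorder\<close>)
      also have "\<dots> \<le> L * exp (var f (W (T i)) (l i) - ?m)"
        using le by simp
      finally have "det (info_matrix f ws) / L \<le> exp (var f (W (T i)) (l i) - ?m)"
        using L0 by (simp add: field_simps)
      then have "d \<le> ln (exp (var f (W (T i)) (l i) - ?m))"
        unfolding d_def using L0 less by (intro ln_mono) auto
      then show ?thesis by simp
    qed
    \<comment> \<open>Increments tend to 0 while the determinants stay above \<open>D 0 > 0\<close>,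
      so a fixed growth factor cannot recur for ever.\<close>
    have small: "\<exists>N. \<forall>i\<ge>N. D (Suc (T i)) < D (T i) * (1 + c / 2)" if c: "0 < c" for c
    proof -
      have "(\<lambda>i. D (Suc (T i)) - D (T i)) \<longlonglongrightarrow> L - L"
        using LIMSEQ_subseq_LIMSEQ[OF L T] LIMSEQ_subseq_LIMSEQ[OF LIMSEQ_Suc[OF L] T]
        by (intro tendsto_diff) (simp_all add: o_def)
      then have "(\<lambda>i. D (Suc (T i)) - D (T i)) \<longlonglongrightarrow> 0" by simp
      moreover have "0 < D 0 * (c / 2)" using D0 c by simp
      ultimately have "\<forall>\<^sub>F i in sequentially. D (Suc (T i)) - D (T i) < D 0 * (c / 2)"
        by (rule order_tendstoD)
      then obtain N where N: "\<And>i. i \<ge> N \<Longrightarrow> D (Suc (T i)) - D (T i) < D 0 * (c / 2)"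
        by (auto simp: eventually_sequentially)
      have "D (Suc (T i)) < D (T i) * (1 + c / 2)" if "i \<ge> N" for i
      proof -
        have "D 0 * (c / 2) \<le> D (T i) * (c / 2)"
          using incseqD[OF inc, of 0 "T i"] c by (intro mult_right_mono) auto
        moreover have "D (T i) * (1 + c / 2) = D (T i) + D (T i) * (c / 2)"
          by (simp add: distrib_left)
        ultimately show ?thesis using N[OF that] by linarith
      qed
      then show ?thesis by blast
    qed
    have gain: "D (T i) * (1 + (if nullifying f (W (T i)) (k i) (l i) then W (T i) $ k i * d
        else d\<^sup>2 / (2 * ?m * (?m + d))) / 2) \<le> D (Suc (T i))" for i
      unfolding D_def lead by (rule leading_exchange_gain[OF reg f k d gap])
    \<comment> \<open>The gain of a non-nullifying leading exchange is such a fixed factor.\<close>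
    have "0 < d\<^sup>2 / (2 * ?m * (?m + d))" using d by simp
    then obtain N where N: "\<And>i. i \<ge> N \<Longrightarrow> D (Suc (T i)) < D (T i) * (1 + d\<^sup>2 / (2 * ?m * (?m + d)) / 2)"
      using small by blast
    have null: "nullifying f (W (T i)) (k i) (l i)" if "i \<ge> N" for i
      using gain[of i] N[OF that] by (auto split: if_splits)
    obtain e where e: "0 < e" "weights_separated e (W (T N))"
      using ex_weights_separated des by blast
    have sep: "weights_separated e (W j)" if "T N \<le> j" for j
      using that
    proof (induction j rule: dec_induct)
      case (step j)
      obtain i where i: "T i \<le> j" "j < T (Suc i)" using strict_mono_block[OF T T0] by blast
      \<comment> \<open>A block before the \<open>N\<close>-th ends at \<open>T N\<close> or earlier
        and cannot contain \<open>j\<close>. So the flag is set for the block of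
        \<open>j\<close>.\<close>
      have "N \<le> i"
      proof (rule ccontr)
        assume "\<not> N \<le> i"
        then have "T (Suc i) \<le> T N" using T by (simp add: strict_mono_less_eq)
        then show False using i step by simp
      qed
      then have "rex_step f True (W j) (W (Suc j))"
        using run_step[OF i] null by simp
      then show ?case using step des by (blast intro: weights_separated_rex_step)
    qed (rule e)
    have "0 < e * d" using e d by simp
    then obtain N' where N': "\<And>i. i \<ge> N' \<Longrightarrow> D (Suc (T i)) < D (T i) * (1 + e * d / 2)"
      using small by blast
    \<comment> \<open>Late enough for both bounds; \<open>k i\<close> lies in the support, so
      separation turns its positive weight into at least \<open>e\<close>.\<close>
    define i where "i = max N N'"
    have "T N \<le> T i" using T by (simp add: i_def strict_mono_less_eq)
    moreover have "0 < W (T i) $ k i" using k[of i] by (simp add: is_arg_min_linorder supp_def)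
    ultimately have "e \<le> W (T i) $ k i"
      using sep[of "T i"] unfolding weights_separated_def by (metis less_irrefl)
    moreover have "0 < D (T i)" using reg by (simp add: D_def regular_designs_iff_det)
    ultimately have "D (T i) * (1 + e * d / 2) \<le> D (T i) * (1 + W (T i) $ k i * d / 2)"
      using d by simp
    then show False using gain[of i] null[of i] N'[of i] by (simp add: i_def)
  qed
  ultimately show ?thesis using L by (simp add: D_def[abs_def])
qed

theorem theorem1:
  fixes f :: "'n::finite \<Rightarrow> real ^ 'm"
    and \<gamma> :: real
    and w0 :: "real ^ 'n"
    and W :: "nat \<Rightarrow> real ^ 'n"
  assumes "\<And>x. f x \<noteq> 0"
    and "span (range f) = UNIV"
    and "\<gamma> \<ge> 1 / real CARD('m)"
    and "w0 \<in> regular_designs f"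
    and "rex_run f \<gamma> w0 W"
  shows "\<exists>ws. D_optimal f ws \<and>
    (\<lambda>i. D_criterion (info_matrix f (W i))) \<longlonglongrightarrow> D_criterion (info_matrix f ws)"
proof -
  have w0: "w0 \<in> designs" using assms(4) by (simp add: regular_designs_def)
  obtain ws where ws: "ws \<in> designs" "D_optimal f ws"
    and max: "\<And>w. w \<in> designs \<Longrightarrow> det (info_matrix f w) \<le> det (info_matrix f ws)"
    using ex_max_det[OF w0, of f] by blast
  \<comment> \<open>The regular initial design makes the limit positive, where the power is
    continuous.\<close>
  have "0 < det (info_matrix f ws)"
    using max[OF w0] assms(4) by (simp add: regular_designs_iff_det)
  moreover have "(\<lambda>i. det (info_matrix f (W i))) \<longlonglongrightarrow> det (info_matrix f ws)"
    using rex_run_det_tendsto[OF assms(1,4,5) ws(1) max] .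
  ultimately have "(\<lambda>i. D_criterion (info_matrix f (W i))) \<longlonglongrightarrow> D_criterion (info_matrix f ws)"
    unfolding D_criterion_def by (intro tendsto_powr tendsto_const) auto
  with ws(2) show ?thesis by blast
qed

end
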